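(* If $u\in\mathbb C[z,w]$ is cyclic in $H^2(\mathbb D^2)$, then $[up]=[p]$ for every $0\ne p\in\mathbb C[z,w]$. In particular, let $p_\lambda(z,w)=1+\lambda z$ with $\lambda\in\mathbb C$, $0<|\lambda|<1$. Then $[p_\lambda]=H^2(\mathbb D^2)$ and, for the submodule $[p_\lambda]$, $$P_zP_w=P_{\mathbb C\mathbf 1},\qquad X_{[p_\lambda]}=0,\qquad C_{[p_\lambda]}=P_{\mathbb C\mathbf 1}.$$ Nevertheless, for $q_\lambda(\zeta)=p_\lambda(\zeta,1)$, $$\frac{\mathfrak M(q_\lambda)^2}{\|q_\lambda\|_2^2}=\frac1{1+|\lambda|^2}<1=\det(I-X_{[p_\lambda]}^*X_{[p_\lambda]}).$$
   Context: $H^2(\mathbb D^2)$ is the Hardy space of the bidisc; $[p]$ is the closure of $p\,\mathbb C[z,w]$ in it; $u$ is cyclic if $[u]=H^2(\mathbb D^2)$. For $\mathcal M=[p]$: $R_z,R_w$ are the restrictions to $\mathcal M$ of multiplication by $z,w$; $P_z=P_{\mathcal M\ominus z\mathcal M}$, $P_w=P_{\mathcal M\ominus w\mathcal M}$; $X_{\mathcal M}=R_z^*R_w-R_wR_z^*$; $C_{\mathcal M}=I-R_zR_z^*-R_wR_w^*+R_zR_wR_z^*R_w^*$. $P_{\mathbb C\mathbf 1}$ is the orthogonal projection onto the constants. $\mathfrak M(q)=\exp\left(\int_{\mathbb T}\log|q|\,dm\right)$ with $m$ normalized Haar measure on $\mathbb T$, $\|q\|_2$ is the norm of $L^2(\mathbb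 T,m)$, and $\det$ is the Fredholm determinant. *)

theory Defs
  imports "HOL-Analysis.Analysis" "HOL-Computational_Algebra.Polynomial"
begin

section \<open>The Hardy space of the bidisc\<close>

definition sq_summable :: "(nat \<times> nat \<Rightarrow> complex) \<Rightarrow> bool" where
  "sq_summable a \<longleftrightarrow> (\<lambda>k. (cmod (a k))\<^sup>2) summable_on UNIV"

text \<open>
  \<open>f\<close> is given on the open bidisc by the power series with coefficients \<open>a\<close>. Values outside
  the bidisc are fixed to be 0, so that two such functions are equal iff they agree on the bidisc.
\<close>

definition bidisc_expansion :: "(nat \<times> nat \<Rightarrow> complex) \<Rightarrow> (complex \<Rightarrow> complex \<Rightarrow> complex) \<Rightarrow> bool" where
  "bidisc_expansion a f \<longleftrightarrow>
     (\<forall>z w. if cmod z < 1 \<and> cmod w < 1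
            then ((\<lambda>(i,j). a (i,j) * z ^ i * w ^ j) has_sum f z w) UNIV
            else f z w = 0)"

lemma sq_summable_zero: "sq_summable (\<lambda>_. 0)"
  by (simp add: sq_summable_def)

lemma bidisc_expansion_zero: "bidisc_expansion (\<lambda>_. 0) (\<lambda>_ _. 0)"
  by (simp add: bidisc_expansion_def case_prod_unfold)

text \<open>
  The Hardy space consists of the holomorphic functions on the bidisc with square summable
  Taylor coefficients. (A square summable family \<open>a\<close> makes the power series converge
  absolutely at every point of the bidisc.)
\<close>

typedef hardy2 = "{f. \<exists>a. sq_summable a \<and> bidisc_expansion a f}"
  morphisms h2_fun Abs_hardy2
  using sq_summable_zero bidisc_expansion_zero by blast

setup_lifting type_definition_hardy2

lemma sq_summable_add:
  assumes "sq_summable a" "sq_summable b"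
  shows "sq_summable (\<lambda>k. a k + b k)"
proof -
  have "(\<lambda>k. 2 * (cmod (a k))\<^sup>2 + 2 * (cmod (b k))\<^sup>2) summable_on UNIV"
    using assms unfolding sq_summable_def
    by (intro summable_on_add summable_on_cmult_right)
  moreover have "(cmod (a k + b k))\<^sup>2 \<le> 2 * (cmod (a k))\<^sup>2 + 2 * (cmod (b k))\<^sup>2" for k
  proof -
    have "(cmod (a k + b k))\<^sup>2 \<le> (cmod (a k) + cmod (b k))\<^sup>2"
      by (intro power_mono norm_triangle_ineq) auto
    also have "\<dots> \<le> 2 * (cmod (a k))\<^sup>2 + 2 * (cmod (b k))\<^sup>2"
      using sum_squares_bound[of "cmod (a k)" "cmod (b k)"] by (simp add: power2_sum)
    finally show ?thesis .
  qed
  ultimately show ?thesis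
    unfolding sq_summable_def
    by (rule summable_on_comparison_test) auto
qed

lemma sq_summable_cmult: "sq_summable a \<Longrightarrow> sq_summable (\<lambda>k. c * a k)"
  unfolding sq_summable_def
  by (simp add: norm_mult power_mult_distrib summable_on_cmult_right)

lemma bidisc_expansion_add:
  assumes "bidisc_expansion a f" "bidisc_expansion b g"
  shows "bidisc_expansion (\<lambda>k. a k + b k) (\<lambda>z w. f z w + g z w)"
  unfolding bidisc_expansion_def
proof (intro allI)
  fix z w :: complex
  show "if cmod z < 1 \<and> cmod w < 1
        then ((\<lambda>(i,j). (a (i,j) + b (i,j)) * z ^ i * w ^ j) has_sum (f z w + g z w)) UNIV
        else f z w + g z w = 0"
  proof (cases "cmod z < 1 \<and> cmod w < 1")
    case True
    then have "((\<lambda>k. (\<lambda>(i,j). a (i,j) * z ^ i * w ^ j) k + (\<lambda>(i,j). b (i,j) * z ^ i * w ^ j) k)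
                 has_sum (f z w + g z w)) UNIV"
      using assms unfolding bidisc_expansion_def by (intro has_sum_add) presburger+
    with True show ?thesis
      by (simp add: case_prod_unfold ring_distribs)
  next
    case False
    then show ?thesis using assms unfolding bidisc_expansion_def by (metis add_0)
  qed
qed

lemma bidisc_expansion_cmult:
  assumes "bidisc_expansion a f"
  shows "bidisc_expansion (\<lambda>k. c * a k) (\<lambda>z w. c * f z w)"
  unfolding bidisc_expansion_def
proof (intro allI)
  fix z w :: complex
  show "if cmod z < 1 \<and> cmod w < 1
        then ((\<lambda>(i,j). c * a (i,j) * z ^ i * w ^ j) has_sum (c * f z w)) UNIV
        else c * f z w = 0"
  proof (cases "cmod z < 1 \<and> cmod w < 1")
    case True
    then have "((\<lambda>k. c * (\<lambda>(i,j). a (i,j) * z ^ i * w ^ j) k) has_sum (c * f z w)) UNIV"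
      using assms unfolding bidisc_expansion_def by (intro has_sum_cmult_right) presburger
    with True show ?thesis
      by (simp add: case_prod_unfold mult.assoc)
  next
    case False
    then show ?thesis using assms unfolding bidisc_expansion_def by (metis mult_zero_right)
  qed
qed

lemma bidisc_expansion_shift:
  fixes m n :: nat
  assumes "sq_summable a" "bidisc_expansion a f"
  defines "b \<equiv> \<lambda>(i,j). if m \<le> i \<and> n \<le> j then a (i - m, j - n) else 0"
  shows "sq_summable b" "bidisc_expansion b (\<lambda>z w. z ^ m * w ^ n * f z w)"
proof -
  define h where "h = (\<lambda>(i,j). (i + m, j + n))"
  have inj: "inj h" by (auto simp: h_def inj_on_def)
  have range: "k \<notin> range h \<Longrightarrow> b k = 0" for k
  proof -
    assume "k \<notin> range h"
    then have "\<not> (m \<le> fst k \<and> n \<le> snd k)"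
      by (metis (mono_tags, lifting) h_def case_prod_conv le_add_diff_inverse2 prod.collapse range_eqI)
    then show ?thesis by (auto simp: b_def case_prod_unfold)
  qed
  have bh: "b (h k) = a k" for k by (auto simp: b_def h_def split: prod.splits)
  have "(\<lambda>k. (cmod (b k))\<^sup>2) summable_on range h"
    using assms(1) inj unfolding sq_summable_def
    by (subst summable_on_reindex) (auto simp: o_def bh)
  then show "sq_summable b"
    unfolding sq_summable_def
    by (rule summable_on_cong_neutral[THEN iffD1, rotated -1]) (auto simp: range)
  show "bidisc_expansion b (\<lambda>z w. z ^ m * w ^ n * f z w)"
    unfolding bidisc_expansion_def
  proof (intro allI)
    fix z w :: complex
    show "if cmod z < 1 \<and> cmod w < 1
          then ((\<lambda>(i,j). b (i,j) * z ^ i * w ^ j) has_sum (z ^ m * w ^ n * f z w)) UNIV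
          else z ^ m * w ^ n * f z w = 0"
    proof (cases "cmod z < 1 \<and> cmod w < 1")
      case True
      then have "((\<lambda>k. z ^ m * w ^ n * (\<lambda>(i,j). a (i,j) * z ^ i * w ^ j) k)
                   has_sum (z ^ m * w ^ n * f z w)) UNIV"
        using assms(2) unfolding bidisc_expansion_def by (intro has_sum_cmult_right) presburger
      also have "(\<lambda>k. z ^ m * w ^ n * (\<lambda>(i,j). a (i,j) * z ^ i * w ^ j) k)
          = (\<lambda>(i,j). b (i,j) * z ^ i * w ^ j) \<circ> h"
        by (auto simp: fun_eq_iff h_def b_def power_add)
      finally have "((\<lambda>(i,j). b (i,j) * z ^ i * w ^ j) has_sum (z ^ m * w ^ n * f z w)) (range h)"
        using has_sum_reindex[OF inj] by blast
      then have "((\<lambda>(i,j). b (i,j) * z ^ i * w ^ j) has_sum (z ^ m * w ^ n * f z w)) UNIV"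
        by (rule has_sum_cong_neutral[THEN iffD1, rotated -1]) (auto simp: range)
      with True show ?thesis by simp
    next
      case False
      then show ?thesis using assms(2) unfolding bidisc_expansion_def by (metis mult_zero_right)
    qed
  qed
qed

lemma sq_summable_imp_mult_summable:
  assumes "sq_summable a" "sq_summable b"
  shows "(\<lambda>k. norm (a k * cnj (b k))) summable_on UNIV"
proof -
  have "(\<lambda>k. (cmod (a k))\<^sup>2 + (cmod (b k))\<^sup>2) summable_on UNIV"
    using assms unfolding sq_summable_def by (rule summable_on_add)
  moreover have "norm (a k * cnj (b k)) \<le> (cmod (a k))\<^sup>2 + (cmod (b k))\<^sup>2" for k
    unfolding norm_mult complex_mod_cnj
    using sum_squares_bound[of "cmod (a k)" "cmod (b k)"]
          mult_nonneg_nonneg[OF norm_ge_zero[of "a k"] norm_ge_zero[of "b k"]]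
    by linarith
  ultimately show ?thesis
    by (rule summable_on_comparison_test) auto
qed

lemma bidisc_expansion_unique_zero:
  assumes c: "bidisc_expansion c (\<lambda>_ _. 0)"
  shows "c = (\<lambda>_. 0)"
proof -
  have zero: "d = (\<lambda>_. 0)"
    if "\<And>z. cmod z < 1 \<Longrightarrow> ((\<lambda>i. d i * z ^ i) has_sum 0) UNIV" for d :: "nat \<Rightarrow> complex"
  proof -
    have s: "(\<lambda>i. d i * z ^ i) sums 0" if "cmod z < 1" for z
      using \<open>\<And>z. cmod z < 1 \<Longrightarrow> ((\<lambda>i. d i * z ^ i) has_sum 0) UNIV\<close>[OF that]
      by (rule has_sum_imp_sums)
    have "conv_radius d \<ge> ereal (cmod (1/2))"
      using s[of "1/2"] by (intro conv_radius_geI) (auto simp: sums_iff)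
    then have r: "fps_conv_radius (Abs_fps d) > 0"
      by (simp add: fps_conv_radius_def o_def) (metis ereal_less(2) half_gt_zero less_le_trans zero_less_one)
    have "eventually (\<lambda>z. z \<in> ball 0 1) (nhds (0::complex))"
      by (intro eventually_nhds_in_open) auto
    then have "eventually (\<lambda>z. eval_fps (Abs_fps d) z = eval_fps 0 z) (nhds 0)"
      by eventually_elim (use s in \<open>auto simp: eval_fps_def sums_iff\<close>)
    then have "Abs_fps d = 0"
      using r by (intro eval_fps_eqD) auto
    then show ?thesis
      by (metis fps_nth_Abs_fps fps_zero_nth ext)
  qed
  have sum: "((\<lambda>(i,j). c (i,j) * z ^ i * w ^ j) has_sum 0) UNIV" if "cmod z < 1" "cmod w < 1" for z w
    using c that unfolding bidisc_expansion_def by presburger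
  have inner_summable: "(\<lambda>j. c (i,j) * w ^ j) summable_on UNIV" if w: "cmod w < 1" for i w
  proof -
    have "(\<lambda>(i,j). c (i,j) * (1/2) ^ i * w ^ j) summable_on UNIV"
      using sum[of "1/2" w] w by (auto simp: summable_on_def)
    then have "(\<lambda>(i,j). c (i,j) * (1/2) ^ i * w ^ j) summable_on (Pair i ` UNIV)"
      by (rule summable_on_subset_banach) auto
    then have "(\<lambda>j. c (i,j) * (1/2) ^ i * w ^ j) summable_on UNIV"
      by (subst (asm) summable_on_reindex) (auto simp: o_def inj_on_def)
    then have "(\<lambda>j. 2 ^ i * (c (i,j) * (1/2) ^ i * w ^ j)) summable_on UNIV"
      by (rule summable_on_cmult_right)
    then show ?thesis by (simp add: field_simps)
  qed
  have d0: "(\<lambda>i. \<Sum>\<^sub>\<infinity>j. c (i,j) * w ^ j) = (\<lambda>_. 0)" if w: "cmod w < 1" for w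
  proof (rule zero)
    fix z :: complex assume z: "cmod z < 1"
    have "((\<lambda>(i,j). c (i,j) * z ^ i * w ^ j) has_sum 0) (Sigma UNIV (\<lambda>_. UNIV))"
      using sum[OF z w] by simp
    moreover have "((\<lambda>j. (\<lambda>(i,j). c (i,j) * z ^ i * w ^ j) (i,j)) has_sum
           (\<Sum>\<^sub>\<infinity>j. c (i,j) * w ^ j) * z ^ i) UNIV" for i
      using has_sum_cmult_left[OF has_sum_infsum[OF inner_summable[OF w, of i]], of "z ^ i"]
      by (simp add: mult_ac)
    ultimately show "((\<lambda>i. (\<Sum>\<^sub>\<infinity>j. c (i,j) * w ^ j) * z ^ i) has_sum 0) UNIV"
      by (rule has_sum_SigmaD)
  qed
  have "(\<lambda>j. c (i,j)) = (\<lambda>_. 0)" for i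
  proof (rule zero)
    fix w :: complex assume w: "cmod w < 1"
    have "(\<Sum>\<^sub>\<infinity>j. c (i,j) * w ^ j) = 0"
      using d0[OF w] by meson
    then show "((\<lambda>j. c (i,j) * w ^ j) has_sum 0) UNIV"
      using has_sum_infsum[OF inner_summable[OF w, of i]] by simp
  qed
  then show ?thesis by (auto simp: fun_eq_iff)
qed

lemma bidisc_expansion_unique:
  assumes "bidisc_expansion a f" "bidisc_expansion b f"
  shows "a = b"
proof -
  have "bidisc_expansion (\<lambda>k. a k + (-1) * b k) (\<lambda>z w. f z w + (-1) * f z w)"
    by (intro bidisc_expansion_add bidisc_expansion_cmult assms)
  then have "(\<lambda>k. a k + (-1) * b k) = (\<lambda>_. 0)"
    by (intro bidisc_expansion_unique_zero) simp
  then show ?thesis by (simp add: fun_eq_iff)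
qed

definition h2_coeff :: "hardy2 \<Rightarrow> nat \<times> nat \<Rightarrow> complex" where
  "h2_coeff f = (THE a. bidisc_expansion a (h2_fun f))"

lemma h2_coeff:
  shows sq_summable_h2_coeff: "sq_summable (h2_coeff f)"
    and bidisc_expansion_h2_coeff: "bidisc_expansion (h2_coeff f) (h2_fun f)"
proof -
  obtain a where a: "sq_summable a" "bidisc_expansion a (h2_fun f)"
    using h2_fun[of f] by auto
  then have "h2_coeff f = a"
    unfolding h2_coeff_def by (blast intro: bidisc_expansion_unique)
  with a show "sq_summable (h2_coeff f)" "bidisc_expansion (h2_coeff f) (h2_fun f)" by auto
qed

lemma h2_coeff_eqI: "bidisc_expansion a (h2_fun f) \<Longrightarrow> h2_coeff f = a"
  using bidisc_expansion_h2_coeff bidisc_expansion_unique by blast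

lemma h2_coeff_inject: "h2_coeff f = h2_coeff g \<longleftrightarrow> f = g"
proof
  assume eq: "h2_coeff f = h2_coeff g"
  have "h2_fun f z w = h2_fun g z w" for z w
  proof (cases "cmod z < 1 \<and> cmod w < 1")
    case True
    then have "((\<lambda>(i,j). h2_coeff k (i,j) * z ^ i * w ^ j) has_sum h2_fun k z w) UNIV" for k
      using bidisc_expansion_h2_coeff[of k] unfolding bidisc_expansion_def by presburger
    from this[of f] this[of g] show ?thesis
      unfolding eq by (rule has_sum_unique)
  next
    case False
    then show ?thesis
      using bidisc_expansion_h2_coeff[of f] bidisc_expansion_h2_coeff[of g]
      unfolding bidisc_expansion_def by metis
  qed
  then show "f = g" by (simp add: h2_fun_inject[symmetric] fun_eq_iff)
qed simp

lift_definition h2_scale :: "complex \<Rightarrow> hardy2 \<Rightarrow> hardy2" is "\<lambda>c f z w. c * f z w"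
  using sq_summable_cmult bidisc_expansion_cmult by blast

lift_definition mult_z :: "hardy2 \<Rightarrow> hardy2" is "\<lambda>f z w. z * f z w"
  using bidisc_expansion_shift[where m = 1 and n = 0] by simp blast

lift_definition mult_w :: "hardy2 \<Rightarrow> hardy2" is "\<lambda>f z w. w * f z w"
  using bidisc_expansion_shift[where m = 0 and n = 1] by simp blast

instantiation hardy2 :: real_vector
begin

lift_definition zero_hardy2 :: hardy2 is "\<lambda>_ _. 0"
  using sq_summable_zero bidisc_expansion_zero by blast

lift_definition plus_hardy2 :: "hardy2 \<Rightarrow> hardy2 \<Rightarrow> hardy2" is "\<lambda>f g z w. f z w + g z w"
  using sq_summable_add bidisc_expansion_add by blast

lift_definition uminus_hardy2 :: "hardy2 \<Rightarrow> hardy2" is "\<lambda>f z w. - f z w"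
proof -
  fix f assume "\<exists>a. sq_summable a \<and> bidisc_expansion a f"
  then obtain a where "sq_summable a" "bidisc_expansion a f" by blast
  from sq_summable_cmult[OF this(1), of "-1"] bidisc_expansion_cmult[OF this(2), of "-1"]
  show "\<exists>a. sq_summable a \<and> bidisc_expansion a (\<lambda>z w. - f z w)"
    by (intro exI[of _ "\<lambda>k. -1 * a k"]) simp
qed

lift_definition minus_hardy2 :: "hardy2 \<Rightarrow> hardy2 \<Rightarrow> hardy2" is "\<lambda>f g z w. f z w - g z w"
proof -
  fix f g
  assume "\<exists>a. sq_summable a \<and> bidisc_expansion a f" "\<exists>b. sq_summable b \<and> bidisc_expansion b g"
  then obtain a b where ab: "sq_summable a" "bidisc_expansion a f" "sq_summable b" "bidisc_expansion b g"
    by blast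
  have "sq_summable (\<lambda>k. a k + -1 * b k)"
    by (intro sq_summable_add sq_summable_cmult ab)
  moreover have "bidisc_expansion (\<lambda>k. a k + -1 * b k) (\<lambda>z w. f z w + -1 * g z w)"
    by (intro bidisc_expansion_add bidisc_expansion_cmult ab)
  ultimately show "\<exists>a. sq_summable a \<and> bidisc_expansion a (\<lambda>z w. f z w - g z w)"
    by (intro exI[of _ "\<lambda>k. a k + -1 * b k"]) simp
qed

lift_definition scaleR_hardy2 :: "real \<Rightarrow> hardy2 \<Rightarrow> hardy2" is "\<lambda>r f z w. r *\<^sub>R f z w"
proof -
  fix r :: real and f
  assume "\<exists>a. sq_summable a \<and> bidisc_expansion a f"
  then obtain a where a: "sq_summable a" "bidisc_expansion a f" by blast
  show "\<exists>a. sq_summable a \<and> bidisc_expansion a (\<lambda>z w. r *\<^sub>R f z w)"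
    using sq_summable_cmult[OF a(1), of "of_real r"] bidisc_expansion_cmult[OF a(2), of "of_real r"]
    by (intro exI[of _ "\<lambda>k. of_real r * a k"]) (simp add: scaleR_conv_of_real)
qed

instance
proof
  fix f g h :: hardy2 and r s :: real
  show "f + g + h = f + (g + h)" by transfer (simp add: add.assoc)
  show "f + g = g + f" by transfer (simp add: add.commute)
  show "0 + f = f" by transfer simp
  show "- f + f = 0" by transfer simp
  show "f - g = f + - g" by transfer simp
  show "r *\<^sub>R (f + g) = r *\<^sub>R f + r *\<^sub>R g" by transfer (simp add: scaleR_right_distrib)
  show "(r + s) *\<^sub>R f = r *\<^sub>R f + s *\<^sub>R f" by transfer (simp add: scaleR_left_distrib)
  show "r *\<^sub>R s *\<^sub>R f = (r * s) *\<^sub>R f" by transfer simp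
  show "1 *\<^sub>R f = f" by transfer simp
qed

end

lemma h2_coeff_zero: "h2_coeff 0 = (\<lambda>_. 0)"
  by (rule h2_coeff_eqI) (simp add: zero_hardy2.rep_eq bidisc_expansion_zero)

lemma h2_coeff_add: "h2_coeff (f + g) = (\<lambda>k. h2_coeff f k + h2_coeff g k)"
  using bidisc_expansion_add[OF bidisc_expansion_h2_coeff bidisc_expansion_h2_coeff]
  by (intro h2_coeff_eqI) (simp add: plus_hardy2.rep_eq)

lemma h2_coeff_scale: "h2_coeff (h2_scale c f) = (\<lambda>k. c * h2_coeff f k)"
  using bidisc_expansion_cmult[OF bidisc_expansion_h2_coeff]
  by (intro h2_coeff_eqI) (simp add: h2_scale.rep_eq)

definition h2_cinner :: "hardy2 \<Rightarrow> hardy2 \<Rightarrow> complex" where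
  "h2_cinner f g = (\<Sum>\<^sub>\<infinity>k. h2_coeff f k * cnj (h2_coeff g k))"

lemma h2_cinner_has_sum:
  "((\<lambda>k. h2_coeff f k * cnj (h2_coeff g k)) has_sum h2_cinner f g) UNIV"
  unfolding h2_cinner_def
  by (rule has_sum_infsum[OF abs_summable_summable
        [OF sq_summable_imp_mult_summable[OF sq_summable_h2_coeff sq_summable_h2_coeff]]])

lemma h2_cinner_add_left: "h2_cinner (f + g) h = h2_cinner f h + h2_cinner g h"
  using has_sum_add[OF h2_cinner_has_sum[of f h] h2_cinner_has_sum[of g h]]
  by (intro has_sum_unique[OF h2_cinner_has_sum]) (simp add: h2_coeff_add ring_distribs)

lemma h2_cinner_scale_left: "h2_cinner (h2_scale c f) g = c * h2_cinner f g"
  using has_sum_cmult_right[OF h2_cinner_has_sum[of f g], of c]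
  by (intro has_sum_unique[OF h2_cinner_has_sum]) (simp add: h2_coeff_scale mult.assoc)

lemma h2_cinner_commute: "h2_cinner g f = cnj (h2_cinner f g)"
  unfolding h2_cinner_def infsum_cnj[symmetric] by (simp only: complex_cnj_mult complex_cnj_cnj mult.commute)

lemma h2_cinner_self_has_sum:
  "((\<lambda>k. (cmod (h2_coeff f k))\<^sup>2) has_sum Re (h2_cinner f f)) UNIV"
  using has_sum_Re[OF h2_cinner_has_sum[of f f]]
  by (simp only: complex_mult_cnj cmod_power2 Re_complex_of_real)

lemma Re_h2_cinner_self_eq_0: "Re (h2_cinner f f) = 0 \<longleftrightarrow> f = 0"
proof
  assume "Re (h2_cinner f f) = 0"
  then have "((\<lambda>k. (cmod (h2_coeff f k))\<^sup>2) has_sum 0) UNIV"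
    using h2_cinner_self_has_sum[of f] by simp
  then have "(cmod (h2_coeff f k))\<^sup>2 = 0" for k
    by (rule nonneg_has_sum_le_0D[where A = UNIV]) auto
  then show "f = 0"
    by (simp add: h2_coeff_inject[symmetric] h2_coeff_zero fun_eq_iff)
qed (simp add: h2_cinner_def h2_coeff_zero)

text \<open>
  The topology is the norm topology of the Hardy space. The real inner product of
  \<^class>\<open>real_inner\<close> is the real part of the complex one; orthogonality, adjoints and
  projections below all use the complex inner product \<^const>\<open>h2_cinner\<close>, linear in its first
  argument.
\<close>

instantiation hardy2 :: real_inner
begin

definition inner_hardy2 :: "hardy2 \<Rightarrow> hardy2 \<Rightarrow> real" where
  "inner_hardy2 f g = Re (h2_cinner f g)"

definition norm_hardy2 :: "hardy2 \<Rightarrow> real" where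
  "norm_hardy2 f = sqrt (inner f f)"

definition sgn_hardy2 :: "hardy2 \<Rightarrow> hardy2" where
  "sgn_hardy2 f = f /\<^sub>R norm f"

definition dist_hardy2 :: "hardy2 \<Rightarrow> hardy2 \<Rightarrow> real" where
  "dist_hardy2 f g = norm (f - g)"

definition uniformity_hardy2 :: "(hardy2 \<times> hardy2) filter" where
  "uniformity_hardy2 = (INF e\<in>{0<..}. principal {(f, g). dist f g < e})"

definition open_hardy2 :: "hardy2 set \<Rightarrow> bool" where
  "open_hardy2 U \<longleftrightarrow> (\<forall>f\<in>U. \<forall>\<^sub>F (f', g) in uniformity. f' = f \<longrightarrow> g \<in> U)"

instance
proof
  fix f g h :: hardy2 and r :: real
  show "inner f g = inner g f"
    by (simp add: inner_hardy2_def h2_cinner_commute[of g f])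
  show "inner (f + g) h = inner f h + inner g h"
    by (simp add: inner_hardy2_def h2_cinner_add_left)
  have "r *\<^sub>R f = h2_scale (of_real r) f"
    by transfer (simp add: scaleR_conv_of_real)
  then show "inner (r *\<^sub>R f) g = r * inner f g"
    by (simp add: inner_hardy2_def h2_cinner_scale_left)
  show "0 \<le> inner f f"
    unfolding inner_hardy2_def by (rule has_sum_nonneg[OF h2_cinner_self_has_sum]) auto
  show "inner f f = 0 \<longleftrightarrow> f = 0"
    by (simp add: inner_hardy2_def Re_h2_cinner_self_eq_0)
qed (simp_all add: norm_hardy2_def sgn_hardy2_def dist_hardy2_def uniformity_hardy2_def
      open_hardy2_def)

end


section \<open>Polynomials in two variables and submodules\<close>

text \<open>
  \<open>complex poly poly\<close> is the polynomial ring in \<open>z\<close>, \<open>w\<close>: \<open>w\<close> is the outer variable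
  and the coefficients are polynomials in \<open>z\<close>.
\<close>

definition poly2 :: "complex poly poly \<Rightarrow> complex \<Rightarrow> complex \<Rightarrow> complex" where
  "poly2 p z w = poly (poly p [:w:]) z"

lemma poly2_pCons: "poly2 (pCons c p) z w = poly c z + w * poly2 p z w"
  by (simp add: poly2_def)

lemma hardy2_poly:
  "\<exists>a. sq_summable a \<and> bidisc_expansion a (\<lambda>z w. if cmod z < 1 \<and> cmod w < 1 then poly2 p z w else 0)"
  (is "\<exists>a. _ \<and> bidisc_expansion a (?f p)")
proof -
  define U :: "complex \<Rightarrow> complex \<Rightarrow> complex"
    where "U = (\<lambda>z w. if cmod z < 1 \<and> cmod w < 1 then 1 else 0)"
  have U: "\<exists>a. sq_summable a \<and> bidisc_expansion a U"
  proof (intro exI conjI)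
    let ?a = "\<lambda>k :: nat \<times> nat. if k = (0,0) then 1 else 0 :: complex"
    have "(\<lambda>k. (cmod (?a k))\<^sup>2) summable_on {(0,0)}" by simp
    then show "sq_summable ?a"
      unfolding sq_summable_def
      by (rule summable_on_cong_neutral[THEN iffD1, rotated -1]) auto
    have "((\<lambda>(i,j). ?a (i,j) * z ^ i * w ^ j) has_sum 1) UNIV" for z w :: complex
    proof -
      have "((\<lambda>(i,j). ?a (i,j) * z ^ i * w ^ j) has_sum 1) {(0,0)}"
        using has_sum_finite[of "{(0,0)}" "\<lambda>(i,j). ?a (i,j) * z ^ i * w ^ j"] by simp
      then show ?thesis
        by (rule has_sum_cong_neutral[THEN iffD1, rotated -1]) (auto split: if_splits)
    qed
    then show "bidisc_expansion ?a U"
      unfolding bidisc_expansion_def U_def by simp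
  qed
  have z: "\<exists>b. sq_summable b \<and> bidisc_expansion b (\<lambda>z w. z * f z w)"
    if "\<exists>a. sq_summable a \<and> bidisc_expansion a f" for f
    using that bidisc_expansion_shift[where m = 1 and n = 0] by simp blast
  have w: "\<exists>b. sq_summable b \<and> bidisc_expansion b (\<lambda>z w. w * f z w)"
    if "\<exists>a. sq_summable a \<and> bidisc_expansion a f" for f
    using that bidisc_expansion_shift[where m = 0 and n = 1] by simp blast
  have add: "\<exists>c. sq_summable c \<and> bidisc_expansion c (\<lambda>z w. f z w + g z w)"
    if "\<exists>a. sq_summable a \<and> bidisc_expansion a f" "\<exists>a. sq_summable a \<and> bidisc_expansion a g"
    for f g
    using that sq_summable_add bidisc_expansion_add by blast
  have one: "\<exists>a. sq_summable a \<and> bidisc_expansion a (\<lambda>z w. poly c z * U z w)" for c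
  proof (induction c)
    case 0
    then show ?case using sq_summable_zero bidisc_expansion_zero by auto
  next
    case (pCons x c)
    have "\<exists>a. sq_summable a \<and> bidisc_expansion a (\<lambda>z w. x * U z w)"
      using U sq_summable_cmult bidisc_expansion_cmult by blast
    from add[OF this z[OF pCons.IH]] show ?case
      by (simp add: ring_distribs mult.assoc)
  qed
  have "\<exists>a. sq_summable a \<and> bidisc_expansion a (\<lambda>z w. poly2 p z w * U z w)"
  proof (induction p)
    case 0
    then show ?case using sq_summable_zero bidisc_expansion_zero by (auto simp: poly2_def)
  next
    case (pCons c p)
    from add[OF one[of c] w[OF pCons.IH]] show ?case
      by (simp add: poly2_pCons ring_distribs mult.assoc)
  qed
  moreover have "(\<lambda>z w. poly2 p z w * U z w) = ?f p"
    by (auto simp: U_def fun_eq_iff)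
  ultimately show ?thesis by simp
qed

lift_definition h2_poly :: "complex poly poly \<Rightarrow> hardy2" is
  "\<lambda>p z w. if cmod z < 1 \<and> cmod w < 1 then poly2 p z w else 0"
  by (rule hardy2_poly)

definition submodule :: "complex poly poly \<Rightarrow> hardy2 set" where
  "submodule p = closure (range (\<lambda>r. h2_poly (p * r)))"

definition cyclic :: "complex poly poly \<Rightarrow> bool" where
  "cyclic u \<longleftrightarrow> submodule u = UNIV"


section \<open>Operators on a closed subspace\<close>

text \<open>
  An operator on a closed subspace \<open>M\<close> is represented by a function on \<^typ>\<open>hardy2\<close> of which
  only the values on \<open>M\<close> matter; in particular the restrictions \<open>R\<^sub>z\<close>, \<open>R\<^sub>w\<close> to \<open>M\<close>
  are represented by \<^const>\<open>mult_z\<close>, \<^const>\<open>mult_w\<close>. Equality of operators on \<open>M\<close> is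
  equality on all elements of \<open>M\<close>.
\<close>

definition adjoint_on :: "hardy2 set \<Rightarrow> (hardy2 \<Rightarrow> hardy2) \<Rightarrow> hardy2 \<Rightarrow> hardy2" where
  "adjoint_on M A g = (THE h. h \<in> M \<and> (\<forall>f\<in>M. h2_cinner (A f) g = h2_cinner f h))"

definition proj_on :: "hardy2 set \<Rightarrow> hardy2 \<Rightarrow> hardy2" where
  "proj_on S f = (THE g. g \<in> S \<and> (\<forall>h\<in>S. h2_cinner (f - g) h = 0))"

definition ortho_diff :: "hardy2 set \<Rightarrow> hardy2 set \<Rightarrow> hardy2 set" where
  "ortho_diff M N = {f \<in> M. \<forall>g\<in>N. h2_cinner f g = 0}"

definition P_z :: "hardy2 set \<Rightarrow> hardy2 \<Rightarrow> hardy2" where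
  "P_z M = proj_on (ortho_diff M (mult_z ` M))"

definition P_w :: "hardy2 set \<Rightarrow> hardy2 \<Rightarrow> hardy2" where
  "P_w M = proj_on (ortho_diff M (mult_w ` M))"

definition P_const :: "hardy2 \<Rightarrow> hardy2" where
  "P_const = proj_on (range (\<lambda>c. h2_poly [:[:c:]:]))"

definition X_op :: "hardy2 set \<Rightarrow> hardy2 \<Rightarrow> hardy2" where
  "X_op M f = adjoint_on M mult_z (mult_w f) - mult_w (adjoint_on M mult_z f)"

definition C_op :: "hardy2 set \<Rightarrow> hardy2 \<Rightarrow> hardy2" where
  "C_op M f = f - mult_z (adjoint_on M mult_z f) - mult_w (adjoint_on M mult_w f)
     + mult_z (mult_w (adjoint_on M mult_z (adjoint_on M mult_w f)))"


section \<open>Fredholm determinant\<close>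

definition orthonormal_basis_of :: "hardy2 set \<Rightarrow> hardy2 set \<Rightarrow> bool" where
  "orthonormal_basis_of M B \<longleftrightarrow> B \<subseteq> M \<and>
     (\<forall>e\<in>B. \<forall>e'\<in>B. h2_cinner e e' = (if e = e' then 1 else 0)) \<and>
     (\<forall>f\<in>M. (\<forall>e\<in>B. h2_cinner f e = 0) \<longrightarrow> f = 0)"

text \<open>
  Trace class operators as nuclear operators: norm-convergent sums of rank one operators
  \<open>f \<mapsto> \<langle>f, x\<^sub>n\<rangle> y\<^sub>n\<close> with \<open>\<Sum>\<^sub>n \<parallel>x\<^sub>n\<parallel> \<parallel>y\<^sub>n\<parallel> < \<infinity>\<close>.
\<close>

definition trace_class_on :: "hardy2 set \<Rightarrow> (hardy2 \<Rightarrow> hardy2) \<Rightarrow> bool" where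
  "trace_class_on M T \<longleftrightarrow> (\<exists>x y :: nat \<Rightarrow> hardy2. range x \<subseteq> M \<and> range y \<subseteq> M \<and>
     summable (\<lambda>n. norm (x n) * norm (y n)) \<and>
     (\<forall>f\<in>M. (\<lambda>n. h2_scale (h2_cinner f (x n)) (y n)) sums T f))"

text \<open>
  The determinant of the matrix of \<open>T\<close> with respect to the finite orthonormal set \<open>F\<close>; it
  equals \<open>\<langle>\<Lambda>\<^sup>k T e\<^sub>F, e\<^sub>F\<rangle>\<close> for \<open>k = card F\<close> and \<open>e\<^sub>F\<close> the wedge product of the
  elements of \<open>F\<close>.
\<close>

definition principal_minor :: "(hardy2 \<Rightarrow> hardy2) \<Rightarrow> hardy2 set \<Rightarrow> complex" where
  "principal_minor T F =
     (\<Sum>\<pi> | \<pi> permutes F. of_int (sign \<pi>) * (\<Prod>e\<in>F. h2_cinner (T e) (\<pi> e)))"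

text \<open>
  For \<open>A = I + T\<close> with \<open>T\<close> of trace class, \<open>det A = \<Sum>\<^sub>k tr (\<Lambda>\<^sup>k T)\<close>. The traces are
  computed in an orthonormal basis of \<open>M\<close>, so that the double sum runs over the finite
  subsets of the basis; it converges absolutely and does not depend on the basis.
\<close>

definition fredholm_det :: "hardy2 set \<Rightarrow> (hardy2 \<Rightarrow> hardy2) \<Rightarrow> complex" where
  "fredholm_det M A = (THE d. trace_class_on M (\<lambda>f. A f - f) \<and>
     (\<forall>B. orthonormal_basis_of M B \<longrightarrow>
        (principal_minor (\<lambda>f. A f - f) has_sum d) {F. finite F \<and> F \<subseteq> B}))"


section \<open>Mahler measure and norm on the circle\<close>

definition circle_measure :: "complex measure" where
  "circle_measure = distr (uniform_measure lborel {0..<2 * pi}) borel cis"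

text \<open>
  \<open>ln 0 = 0\<close> here instead of \<open>-\<infinity>\<close>; for a nonzero polynomial \<open>q\<close> this only affects
  the integrand on a null set.
\<close>

definition mahler :: "(complex \<Rightarrow> complex) \<Rightarrow> real" where
  "mahler q = exp (\<integral>\<zeta>. ln (cmod (q \<zeta>)) \<partial>circle_measure)"

definition circle_norm2 :: "(complex \<Rightarrow> complex) \<Rightarrow> real" where
  "circle_norm2 q = sqrt (\<integral>\<zeta>. (cmod (q \<zeta>))\<^sup>2 \<partial>circle_measure)"

end

(* Multiplication by p is bounded on the Hardy space, so approximating 1 by multiples of u
   approximates p by multiples of u p. For p = 1 + l z with |l| < 1 the partial sums of the
   geometric series invert p modulo an error (-l z)^n r of norm |l|^n ||r||; hence [p] is the
   whole space. There the operators are the coordinate shifts of l^2(N x N) and their adjoints,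
   and every operator identity is read off on Taylor coefficients. The Mahler measure and the
   L^2 norm of q follow from the mean value property for Ln (1 + l z) and 1 + |l|^2 + 2 l z,
   the real part of the latter being |1 + l z|^2 on the circle. *)
theory Submission
  imports Defs "HOL-Complex_Analysis.Cauchy_Integral_Formula"
begin

section \<open>Elements of the Hardy space from their coefficients\<close>

text \<open>Since \<open>2 x y \<le> x^2 + y^2\<close>, each term is bounded by
  \<open>|a k|^2 + |z^i w^j|^2\<close>, and the second family is a product of two convergent
  geometric series.\<close>

lemma bidisc_expansion_exists:
  assumes "sq_summable a"
  shows "\<exists>f. bidisc_expansion a f"
proof -
  have "(\<lambda>(i,j). a (i,j) * z ^ i * w ^ j) summable_on UNIV"
    if z: "cmod z < 1" and w: "cmod w < 1" for z w :: complex
  proof -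
    have geom: "(\<lambda>i. x ^ i) summable_on UNIV" if "0 \<le> x" "x < 1" for x :: real
      using that by (intro norm_summable_imp_summable_on) (simp add: summable_geometric)
    have "(\<lambda>(i,j). ((cmod z)\<^sup>2) ^ i * ((cmod w)\<^sup>2) ^ j) summable_on UNIV \<times> UNIV"
      using z w
      by (intro summable_on_SigmaI[where g = "\<lambda>i. ((cmod z)\<^sup>2) ^ i * (\<Sum>\<^sub>\<infinity>j. ((cmod w)\<^sup>2) ^ j)"])
        (auto simp: abs_square_less_1
          intro!: has_sum_cmult_right has_sum_infsum summable_on_cmult_left geom)
    then have "(\<lambda>k. (cmod (a k))\<^sup>2 + (\<lambda>(i,j). ((cmod z)\<^sup>2) ^ i * ((cmod w)\<^sup>2) ^ j) k) summable_on UNIV"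
      using assms unfolding sq_summable_def by (intro summable_on_add) auto
    moreover have "norm ((\<lambda>(i,j). a (i,j) * z ^ i * w ^ j) k)
        \<le> (cmod (a k))\<^sup>2 + (\<lambda>(i,j). ((cmod z)\<^sup>2) ^ i * ((cmod w)\<^sup>2) ^ j) k" for k
    proof -
      obtain i j where k: "k = (i,j)" by fastforce
      have "((cmod z)\<^sup>2) ^ i * ((cmod w)\<^sup>2) ^ j = (cmod (z ^ i * w ^ j))\<^sup>2"
        by (simp add: norm_mult norm_power power_mult_distrib flip: power_mult)
          (simp add: mult.commute)
      moreover have "norm (a k * (z ^ i * w ^ j)) \<le> (cmod (a k))\<^sup>2 + (cmod (z ^ i * w ^ j))\<^sup>2"
        unfolding norm_mult[of "a k"]
        using sum_squares_bound[of "cmod (a k)" "cmod (z ^ i * w ^ j)"]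
          mult_nonneg_nonneg[OF norm_ge_zero[of "a k"] norm_ge_zero[of "z ^ i * w ^ j"]]
        by linarith
      ultimately show ?thesis by (simp add: k mult.assoc)
    qed
    ultimately have "(\<lambda>k. norm ((\<lambda>(i,j). a (i,j) * z ^ i * w ^ j) k)) summable_on UNIV"
      by (rule summable_on_comparison_test) auto
    then show ?thesis by (rule abs_summable_summable)
  qed
  then have "bidisc_expansion a (\<lambda>z w. if cmod z < 1 \<and> cmod w < 1
      then \<Sum>\<^sub>\<infinity>(i,j). a (i,j) * z ^ i * w ^ j else 0)"
    unfolding bidisc_expansion_def by (auto intro: has_sum_infsum)
  then show ?thesis by blast
qed

text \<open>Inverse of \<open>h2_coeff\<close>: it identifies the Hardy space with l^2(N x N) and is
  meaningful for square summable \<open>a\<close> only.\<close>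

definition h2_of_coeff :: "(nat \<times> nat \<Rightarrow> complex) \<Rightarrow> hardy2" where
  "h2_of_coeff a = (THE f. h2_coeff f = a)"

lemma h2_coeff_h2_of_coeff:
  assumes "sq_summable a"
  shows "h2_coeff (h2_of_coeff a) = a"
proof -
  obtain f where "bidisc_expansion a f" using bidisc_expansion_exists[OF assms] by blast
  then have "h2_coeff (Abs_hardy2 f) = a"
    using assms by (intro h2_coeff_eqI) (subst Abs_hardy2_inverse, auto)
  then show ?thesis
    unfolding h2_of_coeff_def by (rule theI) (simp add: h2_coeff_inject flip: \<open>h2_coeff _ = a\<close>)
qed

lemma hardy2_eqI: "(\<And>k. h2_coeff f k = h2_coeff g k) \<Longrightarrow> f = g"
  by (simp add: fun_eq_iff flip: h2_coeff_inject)

lemma h2_coeff_diff: "h2_coeff (f - g) k = h2_coeff f k - h2_coeff g k"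
  using fun_cong[OF h2_coeff_add[of "f - g" g], of k] by simp

lemma h2_coeff_sum: "h2_coeff (\<Sum>x\<in>A. F x) k = (\<Sum>x\<in>A. h2_coeff (F x) k)"
  by (induction A rule: infinite_finite_induct) (simp_all add: h2_coeff_zero h2_coeff_add)

section \<open>Parseval's identity and the monomial basis\<close>

lemma norm_hardy2_has_sum: "((\<lambda>k. (cmod (h2_coeff f k))\<^sup>2) has_sum (norm f)\<^sup>2) UNIV"
  using h2_cinner_self_has_sum[of f] by (simp add: norm_eq_sqrt_inner inner_hardy2_def has_sum_nonneg)

definition h2_monom :: "nat \<times> nat \<Rightarrow> hardy2" where
  "h2_monom k = h2_of_coeff (\<lambda>k'. if k' = k then 1 else 0)"

lemma h2_coeff_monom: "h2_coeff (h2_monom k) k' = (if k' = k then 1 else 0)"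
proof -
  have "(\<lambda>k'. (cmod (if k' = k then 1 else 0))\<^sup>2) summable_on UNIV"
    by (rule summable_on_cong_neutral[THEN iffD1, OF _ _ _ summable_on_finite[of "{k}"]]) auto
  then show ?thesis
    unfolding h2_monom_def by (subst h2_coeff_h2_of_coeff) (simp_all add: sq_summable_def)
qed

text \<open>A single term of the inner product series survives. Hence identities of inner products
  can be tested coefficient by coefficient.\<close>

lemma h2_cinner_monom: "h2_cinner f (h2_monom k) = h2_coeff f k"
proof -
  have "((\<lambda>k'. h2_coeff f k' * cnj (h2_coeff (h2_monom k) k')) has_sum h2_coeff f k) {k}"
    using has_sum_finite[of "{k}" "\<lambda>k'. h2_coeff f k' * cnj (h2_coeff (h2_monom k) k')"]
    by (simp add: h2_coeff_monom)
  then have "((\<lambda>k'. h2_coeff f k' * cnj (h2_coeff (h2_monom k) k')) has_sum h2_coeff f k) UNIV"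
    by (rule has_sum_cong_neutral[THEN iffD1, rotated -1]) (auto simp: h2_coeff_monom)
  then show ?thesis using h2_cinner_has_sum has_sum_unique by blast
qed

text \<open>Pairing with monomials recovers the conjugated coefficients. This is what makes adjoints
  unique.\<close>

lemma h2_cinner_eqI:
  assumes "\<And>f. h2_cinner f g = h2_cinner f h"
  shows "g = h"
proof (rule hardy2_eqI)
  fix k show "h2_coeff g k = h2_coeff h k"
    using assms[of "h2_monom k"] h2_cinner_commute[of "h2_monom k"] h2_cinner_monom
    by (metis complex_cnj_cancel_iff)
qed

lemma h2_cinner_zero_left [simp]: "h2_cinner 0 f = 0"
  by (simp add: h2_cinner_def h2_coeff_zero)

lemma h2_cinner_zero_right [simp]: "h2_cinner f 0 = 0"
  by (simp add: h2_cinner_def h2_coeff_zero)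

text \<open>Exhibits one orthonormal basis, so that the quantifier over bases in
  \<open>fredholm_det\<close> is not vacuous and pins down the value.\<close>

lemma orthonormal_basis_of_monom: "orthonormal_basis_of UNIV (range h2_monom)"
proof -
  have "h2_monom k = h2_monom k' \<longleftrightarrow> k = k'" for k k'
    using h2_coeff_monom[of k k] h2_coeff_monom[of k' k] by (metis zero_neq_one)
  then show ?thesis
    unfolding orthonormal_basis_of_def
    by (auto simp: h2_cinner_monom h2_coeff_monom h2_coeff_zero intro!: hardy2_eqI)
qed

lemma adjoint_on_UNIV_eqI:
  assumes "\<And>f. h2_cinner (A f) g = h2_cinner f h"
  shows "adjoint_on UNIV A g = h"
  unfolding adjoint_on_def by (rule the_equality) (auto simp: assms intro: h2_cinner_eqI)

lemma sq_summable_reindex: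
  assumes "inj s" "sq_summable a"
  shows "sq_summable (\<lambda>k. a (s k))"
proof -
  have "(\<lambda>k. (cmod (a k))\<^sup>2) summable_on range s"
    using assms(2) unfolding sq_summable_def by (rule summable_on_subset_banach) auto
  then show ?thesis
    using assms(1) by (simp add: sq_summable_def summable_on_reindex o_def)
qed

section \<open>Coordinate projections\<close>

definition h2_restrict :: "(nat \<times> nat) set \<Rightarrow> hardy2 \<Rightarrow> hardy2" where
  "h2_restrict K f = h2_of_coeff (\<lambda>k. if k \<in> K then h2_coeff f k else 0)"

lemma h2_coeff_restrict: "h2_coeff (h2_restrict K f) k = (if k \<in> K then h2_coeff f k else 0)"
proof -
  have "sq_summable (\<lambda>k. if k \<in> K then h2_coeff f k else 0)"
    using sq_summable_h2_coeff[of f] unfolding sq_summable_def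
    by (rule summable_on_comparison_test) auto
  then show ?thesis by (simp add: h2_restrict_def h2_coeff_h2_of_coeff)
qed

text \<open>The difference \<open>f - h2_restrict K f\<close> is supported off \<open>K\<close>, so
  it is termwise orthogonal to everything supported in \<open>K\<close>. For uniqueness, pairing
  with the monomials indexed by \<open>K\<close> fixes the coefficients of any candidate.\<close>

lemma proj_on_support: "proj_on {f. \<forall>k. k \<notin> K \<longrightarrow> h2_coeff f k = 0} f = h2_restrict K f"
  unfolding proj_on_def
proof (rule the_equality, intro conjI ballI)
  fix h assume "h \<in> {f. \<forall>k. k \<notin> K \<longrightarrow> h2_coeff f k = 0}"
  then have "h2_coeff (f - h2_restrict K f) k * cnj (h2_coeff h k) = 0" for k
    by (cases k; cases "k \<in> K") (auto simp: h2_coeff_diff h2_coeff_restrict)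
  then show "h2_cinner (f - h2_restrict K f) h = 0"
    unfolding h2_cinner_def by (rule infsum_0)
next
  fix g assume g: "g \<in> {f. \<forall>k. k \<notin> K \<longrightarrow> h2_coeff f k = 0} \<and>
    (\<forall>h\<in>{f. \<forall>k. k \<notin> K \<longrightarrow> h2_coeff f k = 0}. h2_cinner (f - g) h = 0)"
  show "g = h2_restrict K f"
  proof (rule hardy2_eqI)
    fix k
    have "h2_cinner (f - g) (h2_monom k) = 0" if "k \<in> K"
      using g that by (auto simp: h2_coeff_monom)
    then show "h2_coeff g k = h2_coeff (h2_restrict K f) k"
      using g by (cases k; cases "k \<in> K") (auto simp: h2_cinner_monom h2_coeff_diff h2_coeff_restrict)
  qed
qed (simp add: h2_coeff_restrict)


section \<open>Shifts\<close>

text \<open>\<open>T\<close> moves the coefficient at \<open>k\<close> to position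
  \<open>s k\<close> and fills the remaining positions with zeros. This treats multiplication by z
  and by w at once.\<close>

locale coeff_shift =
  fixes s :: "nat \<times> nat \<Rightarrow> nat \<times> nat" and T :: "hardy2 \<Rightarrow> hardy2"
  assumes inj: "inj s"
    and coeff_range: "h2_coeff (T f) (s k) = h2_coeff f k"
    and coeff_outside: "k \<notin> range s \<Longrightarrow> h2_coeff (T f) k = 0"
begin

text \<open>The adjoint is the backward shift: the series for the left inner product lives on
  \<open>range s\<close>, and reindexing it along the injection \<open>s\<close> turns it into the
  series for the right one.\<close>

lemma
  h2_coeff_adjoint: "h2_coeff (adjoint_on UNIV T g) k = h2_coeff g (s k)" and
  h2_cinner_adjoint: "h2_cinner (T f) g = h2_cinner f (adjoint_on UNIV T g)"
proof -
  define h where "h = h2_of_coeff (\<lambda>k. h2_coeff g (s k))"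
  have h: "h2_coeff h k = h2_coeff g (s k)" for k
    by (simp add: h_def h2_coeff_h2_of_coeff sq_summable_reindex[OF inj] sq_summable_h2_coeff)
  have *: "h2_cinner (T f) g = h2_cinner f h" for f
  proof (rule has_sum_unique[OF h2_cinner_has_sum])
    have "((\<lambda>k. h2_coeff (T f) k * cnj (h2_coeff g k)) has_sum h2_cinner f h) (range s)"
      using h2_cinner_has_sum[of f h] by (simp add: has_sum_reindex[OF inj] o_def h coeff_range)
    then show "((\<lambda>k. h2_coeff (T f) k * cnj (h2_coeff g k)) has_sum h2_cinner f h) UNIV"
      by (rule has_sum_cong_neutral[THEN iffD1, rotated -1]) (auto simp: coeff_outside)
  qed
  then have "adjoint_on UNIV T g = h" by (rule adjoint_on_UNIV_eqI)
  with h * show "h2_coeff (adjoint_on UNIV T g) k = h2_coeff g (s k)"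
    "h2_cinner (T f) g = h2_cinner f (adjoint_on UNIV T g)" by simp_all
qed

lemma norm_shift: "norm (T f) = norm f"
proof -
  have "((\<lambda>k. (cmod (h2_coeff (T f) k))\<^sup>2) has_sum (norm f)\<^sup>2) (range s)"
    using norm_hardy2_has_sum[of f] by (simp add: has_sum_reindex[OF inj] o_def coeff_range)
  then have "((\<lambda>k. (cmod (h2_coeff (T f) k))\<^sup>2) has_sum (norm f)\<^sup>2) UNIV"
    by (rule has_sum_cong_neutral[THEN iffD1, rotated -1]) (auto simp: coeff_outside)
  then have "(norm (T f))\<^sup>2 = (norm f)\<^sup>2"
    using norm_hardy2_has_sum has_sum_unique by blast
  then show ?thesis by simp
qed

text \<open>The orthogonal complement of the range of \<open>T\<close> is the kernel of its adjoint,
  that is, the functions whose coefficients vanish on \<open>range s\<close>.\<close>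

lemma proj_ortho_diff: "proj_on (ortho_diff UNIV (range T)) f = h2_restrict (- range s) f"
proof -
  have "(\<forall>g. h2_cinner f (T g) = 0) \<longleftrightarrow> (\<forall>k\<in>range s. h2_coeff f k = 0)" for f
  proof -
    have "(\<forall>g. h2_cinner f (T g) = 0) \<longleftrightarrow> adjoint_on UNIV T f = 0"
      by (metis complex_cnj_zero_iff h2_cinner_adjoint h2_cinner_commute h2_cinner_eqI
          h2_cinner_zero_right)
    also have "\<dots> \<longleftrightarrow> (\<forall>k. h2_coeff f (s k) = 0)"
      by (simp only: h2_coeff_adjoint h2_coeff_zero fun_eq_iff flip: h2_coeff_inject)
    finally show ?thesis by blast
  qed
  then have "ortho_diff UNIV (range T) = {f. \<forall>k. k \<notin> - range s \<longrightarrow> h2_coeff f k = 0}"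
    unfolding ortho_diff_def by blast
  then show ?thesis by (simp only: proj_on_support)
qed

end

section \<open>The coordinate shifts by z and w\<close>

lemma h2_coeff_mult_z: "h2_coeff (mult_z f) (i, j) = (if 1 \<le> i then h2_coeff f (i - 1, j) else 0)"
proof -
  have "h2_coeff (mult_z f) = (\<lambda>(i,j). if 1 \<le> i \<and> 0 \<le> j then h2_coeff f (i - 1, j - 0) else 0)"
    using bidisc_expansion_shift(2)[OF h2_coeff, of 1 0 f]
    by (intro h2_coeff_eqI) (simp add: mult_z.rep_eq)
  then show ?thesis by simp
qed

lemma h2_coeff_mult_w: "h2_coeff (mult_w f) (i, j) = (if 1 \<le> j then h2_coeff f (i, j - 1) else 0)"
proof -
  have "h2_coeff (mult_w f) = (\<lambda>(i,j). if 0 \<le> i \<and> 1 \<le> j then h2_coeff f (i - 0, j - 1) else 0)"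
    using bidisc_expansion_shift(2)[OF h2_coeff, of 0 1 f]
    by (intro h2_coeff_eqI) (simp add: mult_w.rep_eq)
  then show ?thesis by simp
qed

lemma range_apfst_Suc: "range (apfst Suc) = {k :: nat \<times> nat. fst k \<noteq> 0}"
proof (intro equalityI subsetI)
  fix k :: "nat \<times> nat" assume "k \<in> {k. fst k \<noteq> 0}"
  then have "k = apfst Suc (fst k - 1, snd k)" by (cases k) simp
  then show "k \<in> range (apfst Suc)" by (rule range_eqI)
qed auto

lemma range_apsnd_Suc: "range (apsnd Suc) = {k :: nat \<times> nat. snd k \<noteq> 0}"
proof (intro equalityI subsetI)
  fix k :: "nat \<times> nat" assume "k \<in> {k. snd k \<noteq> 0}"
  then have "k = apsnd Suc (fst k, snd k - 1)" by (cases k) simp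
  then show "k \<in> range (apsnd Suc)" by (rule range_eqI)
qed auto

interpretation z: coeff_shift "apfst Suc" mult_z
proof
  fix k :: "nat \<times> nat" and f assume "k \<notin> range (apfst Suc)"
  then show "h2_coeff (mult_z f) k = 0"
    by (cases k) (simp add: range_apfst_Suc h2_coeff_mult_z)
next
  fix k f show "h2_coeff (mult_z f) (apfst Suc k) = h2_coeff f k"
    by (cases k) (simp add: h2_coeff_mult_z)
qed (auto simp: inj_on_def)

interpretation w: coeff_shift "apsnd Suc" mult_w
proof
  fix k :: "nat \<times> nat" and f assume "k \<notin> range (apsnd Suc)"
  then show "h2_coeff (mult_w f) k = 0"
    by (cases k) (simp add: range_apsnd_Suc h2_coeff_mult_w)
next
  fix k f show "h2_coeff (mult_w f) (apsnd Suc k) = h2_coeff f k"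
    by (cases k) (simp add: h2_coeff_mult_w)
qed (auto simp: inj_on_def)


section \<open>Multiplication by polynomials\<close>

lemma norm_h2_scale: "norm (h2_scale c f) = cmod c * norm f"
proof -
  have "((\<lambda>k. (cmod (h2_coeff (h2_scale c f) k))\<^sup>2) has_sum (cmod c)\<^sup>2 * (norm f)\<^sup>2) UNIV"
    using has_sum_cmult_right[OF norm_hardy2_has_sum[of f]]
    by (simp add: h2_coeff_scale norm_mult power_mult_distrib)
  then have "(norm (h2_scale c f))\<^sup>2 = (cmod c * norm f)\<^sup>2"
    unfolding power_mult_distrib using norm_hardy2_has_sum has_sum_unique by blast
  then show ?thesis by simp
qed

lemma bounded_linear_mult_z: "bounded_linear mult_z"
proof (rule bounded_linear_intro[where K = 1])
  show "mult_z (f + g) = mult_z f + mult_z g" for f g by transfer (simp add: ring_distribs)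
  show "mult_z (r *\<^sub>R f) = r *\<^sub>R mult_z f" for r f by transfer simp
qed (simp add: z.norm_shift)

lemma bounded_linear_mult_w: "bounded_linear mult_w"
proof (rule bounded_linear_intro[where K = 1])
  show "mult_w (f + g) = mult_w f + mult_w g" for f g by transfer (simp add: ring_distribs)
  show "mult_w (r *\<^sub>R f) = r *\<^sub>R mult_w f" for r f by transfer simp
qed (simp add: w.norm_shift)

lemma bounded_linear_h2_scale: "bounded_linear (h2_scale c)"
proof (rule bounded_linear_intro[where K = "cmod c"])
  show "h2_scale c (f + g) = h2_scale c f + h2_scale c g" for f g
    by transfer (simp add: ring_distribs)
  show "h2_scale c (r *\<^sub>R f) = r *\<^sub>R h2_scale c f" for r f by transfer simp
qed (simp add: norm_h2_scale mult.commute)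

lemma poly2_add: "poly2 (p + q) z w = poly2 p z w + poly2 q z w"
  by (simp add: poly2_def)

lemma h2_poly_0: "h2_poly 0 = 0"
  by (simp add: h2_poly.rep_eq zero_hardy2.rep_eq poly2_def fun_eq_iff flip: h2_fun_inject)

lemma h2_poly_add: "h2_poly (p + q) = h2_poly p + h2_poly q"
  by (simp add: h2_poly.rep_eq plus_hardy2.rep_eq poly2_add fun_eq_iff flip: h2_fun_inject)

lemma h2_poly_diff: "h2_poly (p - q) = h2_poly p - h2_poly q"
  using h2_poly_add[of "p - q" q] by simp

lemma h2_poly_scale: "h2_poly ([:[:c:]:] * p) = h2_scale c (h2_poly p)"
  by (simp add: h2_poly.rep_eq h2_scale.rep_eq poly2_def fun_eq_iff flip: h2_fun_inject)

lemma h2_poly_mult_z: "h2_poly ([:[:0, 1:]:] * p) = mult_z (h2_poly p)"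
  by (simp add: h2_poly.rep_eq mult_z.rep_eq poly2_def fun_eq_iff flip: h2_fun_inject)

lemma h2_poly_mult_w: "h2_poly ([:0, 1:] * p) = mult_w (h2_poly p)"
  by (simp add: h2_poly.rep_eq mult_w.rep_eq poly2_def fun_eq_iff flip: h2_fun_inject)

text \<open>Horner's scheme, first in z for the coefficients and then in w, assembles the operator
  from scalings and the two shifts. Its values are recorded on polynomials only, which suffices for
  arguments by closure.\<close>

lemma h2_poly_mult_bounded_linear:
  "\<exists>T. bounded_linear T \<and> (\<forall>q. T (h2_poly q) = h2_poly (p * q))"
proof (induction p)
  case 0
  have "bounded_linear (\<lambda>_ :: hardy2. 0 :: hardy2)" by (rule bounded_linear_zero)
  then show ?case by (intro exI[of _ "\<lambda>_. 0"]) (simp add: h2_poly_0)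
next
  case (pCons c p)
  have "\<exists>T. bounded_linear T \<and> (\<forall>q. T (h2_poly q) = h2_poly ([:c:] * q))"
  proof (induction c)
    case 0
    have "bounded_linear (\<lambda>_ :: hardy2. 0 :: hardy2)" by (rule bounded_linear_zero)
    then show ?case by (intro exI[of _ "\<lambda>_. 0"]) (simp add: h2_poly_0)
  next
    case (pCons x c)
    then obtain T where T: "bounded_linear T" "\<And>q. T (h2_poly q) = h2_poly ([:c:] * q)" by blast
    \<comment> \<open>Horner step in the inner variable: the new coefficient polynomial is
      \<open>x + z c\<close>.\<close>
    have "[:pCons x c:] = [:[:x:]:] + [:[:0, 1:]:] * [:c:]" by simp
    then have "[:pCons x c:] * q = [:[:x:]:] * q + [:[:0, 1:]:] * ([:c:] * q)" for q :: "complex poly poly"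
      by (metis distrib_right mult.assoc)
    from arg_cong[OF this, of h2_poly]
    have "h2_scale x (h2_poly q) + mult_z (T (h2_poly q)) = h2_poly ([:pCons x c:] * q)" for q
      by (simp only: T(2) h2_poly_add h2_poly_scale h2_poly_mult_z)
    moreover have "bounded_linear (\<lambda>f. h2_scale x f + mult_z (T f))"
      by (intro bounded_linear_add bounded_linear_h2_scale
            bounded_linear_compose[OF bounded_linear_mult_z] T)
    ultimately show ?case by blast
  qed
  then obtain S where S: "bounded_linear S" "\<And>q. S (h2_poly q) = h2_poly ([:c:] * q)" by blast
  from pCons obtain T where T: "bounded_linear T" "\<And>q. T (h2_poly q) = h2_poly (p * q)" by blast
  \<comment> \<open>Horner step in the outer variable, \<open>c + w p\<close>.\<close>
  have "pCons c p * q = [:c:] * q + [:0, 1:] * (p * q)" for q :: "complex poly poly" by simp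
  then have "(\<lambda>f. S f + mult_w (T f)) (h2_poly q) = h2_poly (pCons c p * q)" for q
    by (simp add: h2_poly_add S T(2) h2_poly_mult_w del: mult_pCons_left)
  moreover have "bounded_linear (\<lambda>f. S f + mult_w (T f))"
    by (intro bounded_linear_add bounded_linear_compose[OF bounded_linear_mult_w] S T)
  ultimately show ?case by blast
qed

text \<open>Multiples of \<open>u p\<close> are multiples of \<open>p\<close>, which gives one
  inclusion. For the other, let \<open>T\<close> be multiplication by \<open>p\<close>: it sends
  multiples of \<open>u\<close> to multiples of \<open>u p\<close>, hence by continuity the closure
  [u] into [up].\<close>

lemma cyclic_submodule_mult:
  assumes "cyclic u"
  shows "submodule (u * p) = submodule p"
proof
  show "submodule (u * p) \<subseteq> submodule p"
    unfolding submodule_def by (rule closure_mono) (auto simp: mult.assoc mult.left_commute[of u])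
  obtain T where T: "bounded_linear T" "\<And>q. T (h2_poly q) = h2_poly (p * q)"
    using h2_poly_mult_bounded_linear by blast
  have "T ` closure (range (\<lambda>r. h2_poly (u * r))) \<subseteq> submodule (u * p)"
  proof (rule image_closure_subset)
    have "T (h2_poly (u * r)) = h2_poly (u * p * r)" for r by (simp add: T(2) mult_ac)
    then have "T ` range (\<lambda>r. h2_poly (u * r)) \<subseteq> range (\<lambda>r. h2_poly (u * p * r))" by auto
    then show "T ` range (\<lambda>r. h2_poly (u * r)) \<subseteq> submodule (u * p)"
      unfolding submodule_def using closure_subset by (rule order.trans)
  qed (auto simp: submodule_def intro: bounded_linear.continuous_on T)
  \<comment> \<open>Cyclicity enters here: the closure mapped by \<open>T\<close> is the whole
    space, so in particular it contains every polynomial \<open>r\<close>, and \<open>T\<close> maps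
    it to \<open>p r\<close>.\<close>
  then have "range T \<subseteq> submodule (u * p)"
    using assms by (simp add: cyclic_def submodule_def)
  then have "range (\<lambda>r. h2_poly (p * r)) \<subseteq> submodule (u * p)"
    by (auto simp flip: T(2))
  then show "submodule p \<subseteq> submodule (u * p)"
    unfolding submodule_def[of p] by (rule closure_minimal) (simp add: submodule_def)
qed


section \<open>Density of polynomials\<close>

lemma h2_monom_Suc_left: "h2_monom (Suc i, j) = mult_z (h2_monom (i, j))"
proof (rule hardy2_eqI)
  fix k show "h2_coeff (h2_monom (Suc i, j)) k = h2_coeff (mult_z (h2_monom (i, j))) k"
    by (cases k) (simp add: h2_coeff_monom h2_coeff_mult_z, presburger)
qed

lemma h2_monom_Suc_right: "h2_monom (i, Suc j) = mult_w (h2_monom (i, j))"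
proof (rule hardy2_eqI)
  fix k show "h2_coeff (h2_monom (i, Suc j)) k = h2_coeff (mult_w (h2_monom (i, j))) k"
    by (cases k) (simp add: h2_coeff_monom h2_coeff_mult_w, presburger)
qed

lemma h2_poly_const: "h2_poly [:[:c:]:] = h2_scale c (h2_monom (0, 0))"
proof -
  have "((\<lambda>(i,j). c * (if (i,j) = (0,0) then 1 else 0) * z ^ i * w ^ j) has_sum c) UNIV"
    for z w :: complex
  proof -
    have "((\<lambda>(i,j). c * (if (i,j) = (0,0) then 1 else 0) * z ^ i * w ^ j) has_sum c) {(0,0)}"
      using has_sum_finite[of "{(0,0)}"
          "\<lambda>(i,j). c * (if (i,j) = (0,0) then 1 else 0) * z ^ i * w ^ j"] by simp
    then show ?thesis
      by (rule has_sum_cong_neutral[THEN iffD1, rotated -1]) (auto split: if_splits)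
  qed
  then have "h2_coeff (h2_poly [:[:c:]:]) = (\<lambda>k. c * (if k = (0,0) then 1 else 0))"
    by (intro h2_coeff_eqI) (simp add: bidisc_expansion_def h2_poly.rep_eq poly2_def)
  then show ?thesis by (intro hardy2_eqI) (simp add: h2_coeff_scale h2_coeff_monom)
qed

lemma h2_monom_in_range: "h2_monom (i, j) \<in> range h2_poly"
proof (induction i)
  case 0
  show ?case
  proof (induction j)
    case 0
    have "h2_monom (0, 0) = h2_poly [:[:1:]:]"
      unfolding h2_poly_const by (rule hardy2_eqI) (simp add: h2_coeff_scale)
    then show ?case by simp
  next
    case (Suc j)
    then show ?case by (auto simp: h2_monom_Suc_right simp flip: h2_poly_mult_w)
  qed
next
  case (Suc i)
  then show ?case by (auto simp: h2_monom_Suc_left simp flip: h2_poly_mult_z)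
qed

text \<open>Finite truncations of the Taylor series are polynomials, and by Parseval the squared
  error is the tail of the series of squared coefficients.\<close>

lemma closure_range_h2_poly: "closure (range h2_poly) = UNIV"
proof -
  have "f \<in> closure (range h2_poly)" for f
    unfolding closure_approachable
  proof (intro allI impI)
    fix e :: real assume "e > 0"
    \<comment> \<open>The approximation lemma yields a non-strict bound; taking half of
      \<open>e^2\<close> makes it strict.\<close>
    then obtain K where K: "finite K" "\<bar>(\<Sum>k\<in>K. (cmod (h2_coeff f k))\<^sup>2) - (norm f)\<^sup>2\<bar> < e\<^sup>2"
      using has_sum_finite_approximation[OF norm_hardy2_has_sum[of f], of "e\<^sup>2 / 2"]
      by (auto simp: dist_real_def) (smt (verit) field_sum_of_halves zero_less_power)
    define g where "g = (\<Sum>k\<in>K. h2_scale (h2_coeff f k) (h2_monom k))"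
    have g: "h2_coeff g k = (if k \<in> K then h2_coeff f k else 0)" for k
      using K(1) by (simp add: g_def h2_coeff_sum h2_coeff_scale h2_coeff_monom mult_delta_right)
    have scaled: "h2_scale c (h2_monom k) \<in> range h2_poly" for c k
      using h2_monom_in_range[of "fst k" "snd k"] by (auto simp flip: h2_poly_scale)
    have "g \<in> range h2_poly"
      unfolding g_def using K(1)
    proof (induction K)
      case empty
      show ?case by (metis h2_poly_0 rangeI sum.empty)
    next
      case (insert k K)
      with scaled obtain p q where "h2_scale (h2_coeff f k) (h2_monom k) = h2_poly p"
        "(\<Sum>k\<in>K. h2_scale (h2_coeff f k) (h2_monom k)) = h2_poly q" by (metis imageE)
      with insert.hyps show ?case by (simp flip: h2_poly_add)
    qed
    moreover have "dist g f < e"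
    proof -
      \<comment> \<open>The coefficients of \<open>f - g\<close> are those of \<open>f\<close> off
        \<open>K\<close> and zero on \<open>K\<close>.\<close>
      have "((\<lambda>k. (cmod (h2_coeff f k))\<^sup>2) has_sum
          (norm f)\<^sup>2 - (\<Sum>k\<in>K. (cmod (h2_coeff f k))\<^sup>2)) (UNIV - K)"
        using K(1) by (intro has_sum_Diff norm_hardy2_has_sum has_sum_finite) auto
      then have "((\<lambda>k. (cmod (h2_coeff (f - g) k))\<^sup>2) has_sum
          (norm f)\<^sup>2 - (\<Sum>k\<in>K. (cmod (h2_coeff f k))\<^sup>2)) UNIV"
        by (rule has_sum_cong_neutral[THEN iffD1, rotated -1]) (auto simp: h2_coeff_diff g)
      then have "(norm (f - g))\<^sup>2 = (norm f)\<^sup>2 - (\<Sum>k\<in>K. (cmod (h2_coeff f k))\<^sup>2)"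
        using norm_hardy2_has_sum has_sum_unique by blast
      then have "(norm (f - g))\<^sup>2 < e\<^sup>2" using K(2) by linarith
      then show ?thesis
        using \<open>e > 0\<close> by (simp add: dist_norm norm_minus_commute power_less_imp_less_base)
    qed
    ultimately show "\<exists>g\<in>range h2_poly. dist g f < e" by blast
  qed
  then show ?thesis by blast
qed

lemma submodule_linear_factor:
  assumes "cmod l < 1"
  shows "submodule [:[:1, l:]:] = UNIV"
proof -
  \<comment> \<open>The sign is chosen so that the generator is \<open>1 - x\<close>, whose
    approximate inverses are the partial sums of the powers of \<open>x\<close>.\<close>
  define x where "x = ([:[:0, -l:]:] :: complex poly poly)"
  have p: "[:[:1, l:]:] = 1 - x" by (simp add: x_def one_pCons)
  have "h2_poly r \<in> submodule (1 - x)" for r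
  proof -
    \<comment> \<open>The equality is exact because multiplication by z is isometric.\<close>
    have "norm (h2_poly (x ^ n * r)) = cmod l ^ n * norm (h2_poly r)" for n
    proof (induction n)
      case (Suc n)
      have "x ^ Suc n * r = [:[:-l:]:] * ([:[:0, 1:]:] * (x ^ n * r))"
        by (simp add: x_def mult.assoc)
      then show ?case
        by (simp only: h2_poly_scale h2_poly_mult_z norm_h2_scale z.norm_shift Suc.IH) simp
    qed simp
    moreover have "(\<lambda>n. cmod l ^ n * norm (h2_poly r)) \<longlonglongrightarrow> 0 * norm (h2_poly r)"
      using assms by (intro tendsto_mult_right LIMSEQ_power_zero) auto
    ultimately have "(\<lambda>n. h2_poly (x ^ n * r)) \<longlonglongrightarrow> 0"
      by (simp add: tendsto_norm_zero_iff[symmetric, where f = "\<lambda>n. h2_poly (x ^ n * r)"])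
    then have "(\<lambda>n. h2_poly r - h2_poly (x ^ n * r)) \<longlonglongrightarrow> h2_poly r - 0"
      by (intro tendsto_diff tendsto_const)
    moreover have "h2_poly r - h2_poly (x ^ n * r) = h2_poly ((1 - x) * ((\<Sum>i<n. x ^ i) * r))" for n
    proof -
      have "r - x ^ n * r = (1 - x ^ n) * r" by (simp add: algebra_simps)
      also have "1 - x ^ n = (1 - x) * (\<Sum>i<n. x ^ i)" by (rule one_diff_power_eq)
      finally show ?thesis by (simp add: mult.assoc flip: h2_poly_diff)
    qed
    ultimately show ?thesis
      unfolding submodule_def closure_sequential
      by (intro exI[of _ "\<lambda>n. h2_poly ((1 - x) * ((\<Sum>i<n. x ^ i) * r))"]) auto
  qed
  then have "closure (range h2_poly) \<subseteq> submodule (1 - x)"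
    by (intro closure_minimal) (auto simp: submodule_def)
  then show ?thesis by (auto simp: closure_range_h2_poly p)
qed


section \<open>The operators of the full space\<close>

lemma P_const_eq: "P_const = h2_restrict {(0, 0)}"
proof -
  have "range (\<lambda>c. h2_poly [:[:c:]:]) = {f. \<forall>k. k \<notin> {(0, 0)} \<longrightarrow> h2_coeff f k = 0}"
  proof (intro equalityI subsetI)
    fix f assume "f \<in> {f. \<forall>k. k \<notin> {(0, 0)} \<longrightarrow> h2_coeff f k = 0}"
    then have "f = h2_poly [:[:h2_coeff f (0, 0):]:]"
      by (intro hardy2_eqI) (auto simp: h2_poly_const h2_coeff_scale h2_coeff_monom)
    then show "f \<in> range (\<lambda>c. h2_poly [:[:c:]:])" by blast
  qed (auto simp: h2_poly_const h2_coeff_scale h2_coeff_monom)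
  then show ?thesis
    by (simp only: P_const_def fun_eq_iff proj_on_support simp_thms)
qed

text \<open>The two projections keep the coefficients with \<open>i = 0\<close> and with
  \<open>j = 0\<close>; only the origin satisfies both.\<close>

lemma P_z_P_w_UNIV: "P_z UNIV (P_w UNIV f) = P_const f"
proof (rule hardy2_eqI)
  fix k show "h2_coeff (P_z UNIV (P_w UNIV f)) k = h2_coeff (P_const f) k"
    by (cases k) (simp add: P_z_def P_w_def z.proj_ortho_diff w.proj_ortho_diff P_const_eq
        h2_coeff_restrict range_apfst_Suc range_apsnd_Suc)
qed

text \<open>The backward shift in one index commutes with the forward shift in the other.\<close>

lemma X_op_UNIV: "X_op UNIV f = 0"
proof (rule hardy2_eqI)
  fix k show "h2_coeff (X_op UNIV f) k = h2_coeff 0 k"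
    by (cases k) (simp add: X_op_def h2_coeff_diff h2_coeff_zero z.h2_coeff_adjoint h2_coeff_mult_w)
qed

text \<open>Inclusion-exclusion: the coefficient at \<open>(i, j)\<close> is multiplied by
  \<open>1 - [i \<ge> 1] - [j \<ge> 1] + [i \<ge> 1][j \<ge> 1]\<close>, which is 1 at the origin
  and 0 elsewhere.\<close>

lemma C_op_UNIV: "C_op UNIV f = P_const f"
proof (rule hardy2_eqI)
  fix k show "h2_coeff (C_op UNIV f) k = h2_coeff (P_const f) k"
    by (cases k) (auto simp: C_op_def P_const_eq h2_coeff_restrict h2_coeff_diff h2_coeff_add
        z.h2_coeff_adjoint w.h2_coeff_adjoint h2_coeff_mult_w h2_coeff_mult_z)
qed

lemma fredholm_det_UNIV_id: "fredholm_det UNIV (\<lambda>f. f) = 1"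
proof -
  \<comment> \<open>For nonempty \<open>F\<close> every product contains a factor 0. For empty
    \<open>F\<close> the identity is the only permutation and the empty product is 1.\<close>
  have minor: "principal_minor (\<lambda>_. 0) F = (if F = {} then 1 else 0)" if "finite F" for F
    using that by (auto simp: principal_minor_def power_0_left card_eq_0_iff)
  have "(principal_minor (\<lambda>_. 0) has_sum 1) {F. finite F \<and> F \<subseteq> B}" for B
  proof -
    have "(principal_minor (\<lambda>_. 0) has_sum 1) {{}}"
      using has_sum_finite[of "{{}}" "principal_minor (\<lambda>_. 0)"] by (simp add: minor)
    then show ?thesis
      by (rule has_sum_cong_neutral[THEN iffD1, rotated -1]) (auto simp: minor)
  qed
  moreover have "trace_class_on UNIV (\<lambda>_. 0)"
    unfolding trace_class_on_def
  proof (intro exI conjI ballI)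
    fix f
    have "h2_scale c 0 = 0" for c by transfer simp
    then show "(\<lambda>n. h2_scale (h2_cinner f ((\<lambda>_. 0) n)) ((\<lambda>_. 0) n)) sums 0" by simp
  qed auto
  ultimately show ?thesis
    unfolding fredholm_det_def using orthonormal_basis_of_monom
    by (intro the_equality) (auto dest: has_sum_unique)
qed


section \<open>Means over the circle\<close>

text \<open>Rewrites the mean over the circle as a gauge integral over an angle, the form in which
  contour integrals along arcs are given.\<close>

lemma circle_integral_eq:
  fixes h :: "complex \<Rightarrow> real"
  assumes h [measurable]: "h \<in> borel_measurable borel"
    and cont: "continuous_on {0..2 * pi} (\<lambda>t. h (cis t))"
  shows "(\<integral>\<zeta>. h \<zeta> \<partial>circle_measure) = integral {0..2 * pi} (\<lambda>t. h (cis t)) / (2 * pi)"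
proof -
  have cis [measurable]: "cis \<in> borel_measurable borel"
    by (intro borel_measurable_continuous_onI continuous_intros)
  have "uniform_measure lborel {0..<2 * pi}
      = density lborel (\<lambda>t. ennreal (indicator {0..<2 * pi} t / (2 * pi)))"
    unfolding uniform_measure_def
    by (intro density_cong) (auto simp: indicator_def divide_ennreal simp flip: ennreal_1)
  then have "(\<integral>\<zeta>. h \<zeta> \<partial>circle_measure)
      = (\<integral>t. (indicator {0..<2 * pi} t / (2 * pi)) *\<^sub>R h (cis t) \<partial>lborel)"
    unfolding circle_measure_def by (simp add: integral_distr integral_density)
  \<comment> \<open>Passing from the half-open to the closed interval changes the integrand at the
    null set \<open>{2 * pi}\<close> only.\<close>
  also have "\<dots> = (\<integral>t. (indicator {0..2 * pi} t *\<^sub>R h (cis t)) / (2 * pi) \<partial>lborel)"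
    by (intro integral_cong_AE eventually_mono[OF AE_lborel_singleton[of "2 * pi"]])
      (auto simp: indicator_def)
  also have "\<dots> = (LINT t:{0..2 * pi}|lborel. h (cis t)) / (2 * pi)"
    by (simp add: set_lebesgue_integral_def)
  also have "(LINT t:{0..2 * pi}|lborel. h (cis t)) = integral {0..2 * pi} (\<lambda>t. h (cis t))"
    by (intro set_borel_integral_eq_integral borel_integrable_atLeastAtMost' cont)
  finally show ?thesis .
qed

text \<open>The mean value property, from Cauchy's formula at the centre. Agreement of
  \<open>h\<close> with \<open>Re f\<close> is asked on the circle alone, so that \<open>h\<close>
  may be a function such as \<open>|1 + l z|^2\<close>, which is not harmonic inside for
  \<open>l \<noteq> 0\<close>.\<close>

lemma circle_integral_Re_holomorphic:
  assumes "h \<in> borel_measurable borel" and f: "f holomorphic_on cball 0 1"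
    and h: "\<And>\<zeta>. cmod \<zeta> = 1 \<Longrightarrow> h \<zeta> = Re (f \<zeta>)"
  shows "(\<integral>\<zeta>. h \<zeta> \<partial>circle_measure) = Re (f 0)"
proof -
  have "((\<lambda>u. f u / (u - 0)) has_contour_integral 2 * of_real pi * \<i> * f 0) (circlepath 0 1)"
    using f by (intro Cauchy_integral_circlepath_simple) auto
  \<comment> \<open>With \<open>u = cis t\<close>, the factor \<open>1 / u\<close> cancels against
    \<open>du = \<i> u dt\<close> and leaves the constant \<open>\<i>\<close>, removed next by
    multiplying with \<open>- \<i>\<close>.\<close>
  then have "((\<lambda>t. f (cis t) * \<i>) has_integral 2 * of_real pi * \<i> * f 0) {0..2 * pi}"
    by (simp add: circlepath_def has_contour_integral_part_circlepath_iff)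
  from has_integral_mult_right[OF this, of "- \<i>"]
  have "((\<lambda>t. f (cis t)) has_integral of_real (2 * pi) * f 0) {0..2 * pi}"
    by (simp add: algebra_simps)
  from has_integral_linear[OF this bounded_linear_Re]
  have "((\<lambda>t. Re (f (cis t))) has_integral 2 * pi * Re (f 0)) {0..2 * pi}"
    by (simp add: o_def)
  then have int: "integral {0..2 * pi} (\<lambda>t. h (cis t)) = 2 * pi * Re (f 0)"
    by (simp add: h integral_unique)
  have "continuous_on {0..2 * pi} (\<lambda>t. Re (f (cis t)))"
    by (intro continuous_on_Re continuous_on_compose2[OF holomorphic_on_imp_continuous_on[OF f]]
          continuous_intros) auto
  then have "continuous_on {0..2 * pi} (\<lambda>t. h (cis t))" by (simp add: h)
  from circle_integral_eq[OF assms(1) this] show ?thesis by (simp add: int)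
qed

lemma mahler_linear:
  assumes "cmod l < 1"
  shows "mahler (\<lambda>\<zeta>. 1 + l * \<zeta>) = 1"
proof -
  \<comment> \<open>A positive real part keeps \<open>1 + l \<zeta>\<close> away from the branch cut
    of \<open>Ln\<close> on the closed disc.\<close>
  have pos: "Re (1 + l * \<zeta>) > 0" if "cmod \<zeta> \<le> 1" for \<zeta>
  proof -
    have "cmod (l * \<zeta>) \<le> cmod l * 1"
      unfolding norm_mult using that by (intro mult_left_mono) auto
    with assms abs_Re_le_cmod[of "l * \<zeta>"] show ?thesis by simp
  qed
  have "(\<integral>\<zeta>. ln (cmod (1 + l * \<zeta>)) \<partial>circle_measure) = Re (Ln (1 + l * 0))"
  proof (rule circle_integral_Re_holomorphic)
    show "(\<lambda>\<zeta>. Ln (1 + l * \<zeta>)) holomorphic_on cball 0 1"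
      using pos by (intro holomorphic_intros) (force simp: complex_nonpos_Reals_iff)
    show "ln (cmod (1 + l * \<zeta>)) = Re (Ln (1 + l * \<zeta>))" if "cmod \<zeta> = 1" for \<zeta>
    proof -
      have "1 + l * \<zeta> \<noteq> 0" using pos[of \<zeta>] that by (metis less_irrefl order_refl zero_complex.sel(1))
      then show ?thesis by simp
    qed
  qed measurable
  then show ?thesis by (simp add: mahler_def)
qed

lemma circle_norm2_linear: "(circle_norm2 (\<lambda>\<zeta>. 1 + l * \<zeta>))\<^sup>2 = 1 + (cmod l)\<^sup>2"
proof -
  have "(\<integral>\<zeta>. (cmod (1 + l * \<zeta>))\<^sup>2 \<partial>circle_measure) = Re (of_real (1 + (cmod l)\<^sup>2) + 2 * l * 0)"
  proof (rule circle_integral_Re_holomorphic)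
    fix \<zeta> :: complex assume "cmod \<zeta> = 1"
    then have "cmod (l * \<zeta>) = cmod l" by (simp add: norm_mult)
    \<comment> \<open>On the circle \<open>x = l \<zeta>\<close> has modulus \<open>|l|\<close>, so
      the square is the real part of an affine function of \<open>\<zeta>\<close>; its value at 0 is
      \<open>1 + |l|^2\<close>.\<close>
    moreover have "(cmod (1 + x))\<^sup>2 = 1 + (cmod x)\<^sup>2 + 2 * Re x" for x
      unfolding cmod_power2 by (simp add: power2_eq_square algebra_simps)
    ultimately have "(cmod (1 + l * \<zeta>))\<^sup>2 = 1 + (cmod l)\<^sup>2 + 2 * Re (l * \<zeta>)" by metis
    then show "(cmod (1 + l * \<zeta>))\<^sup>2 = Re (of_real (1 + (cmod l)\<^sup>2) + 2 * l * \<zeta>)" by simp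
  qed (measurable, intro holomorphic_intros)
  then show ?thesis by (simp add: circle_norm2_def add_nonneg_nonneg)
qed

theorem proposition10p8:
  shows "(\<forall>u :: complex poly poly. cyclic u \<longrightarrow>
            (\<forall>p :: complex poly poly. p \<noteq> 0 \<longrightarrow> submodule (u * p) = submodule p)) \<and>
         (\<forall>l :: complex. 0 < cmod l \<and> cmod l < 1 \<longrightarrow>
            (let p = [:[:1, l:]:] :: complex poly poly;
                 M = submodule p;
                 q = (\<lambda>\<zeta>. poly2 p \<zeta> 1)
             in M = UNIV \<and>
                (\<forall>f\<in>M. P_z M (P_w M f) = P_const f) \<and>
                (\<forall>f\<in>M. X_op M f = 0) \<and>
                (\<forall>f\<in>M. C_op M f = P_const f) \<and>
                (mahler q)\<^sup>2 / (circle_norm2 q)\<^sup>2 = 1 / (1 + (cmod l)\<^sup>2) \<and>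
                1 / (1 + (cmod l)\<^sup>2) < 1 \<and>
                fredholm_det M (\<lambda>f. f - adjoint_on M (X_op M) (X_op M f)) = 1))"
proof (intro conjI allI impI)
  fix u p :: "complex poly poly" assume "cyclic u"
  then show "submodule (u * p) = submodule p" by (rule cyclic_submodule_mult)
next
  fix l :: complex assume l: "0 < cmod l \<and> cmod l < 1"
  then have M: "submodule [:[:1, l:]:] = UNIV" by (intro submodule_linear_factor) simp
  have q: "poly2 [:[:1, l:]:] \<zeta> 1 = 1 + l * \<zeta>" for \<zeta> by (simp add: poly2_def mult.commute)
  \<comment> \<open>As \<open>X_op\<close> vanishes, the adjoint is evaluated only at 0; this
    reduces the operator in the determinant to the identity.\<close>
  have "adjoint_on UNIV (X_op UNIV) 0 = 0"
    by (rule adjoint_on_UNIV_eqI) simp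
  moreover have "1 / (1 + (cmod l)\<^sup>2) < 1"
    using l by (simp add: divide_less_eq_1 sum_power2_gt_zero_iff add_pos_nonneg)
  ultimately show "let p = [:[:1, l:]:] :: complex poly poly;
                 M = submodule p;
                 q = (\<lambda>\<zeta>. poly2 p \<zeta> 1)
             in M = UNIV \<and>
                (\<forall>f\<in>M. P_z M (P_w M f) = P_const f) \<and>
                (\<forall>f\<in>M. X_op M f = 0) \<and>
                (\<forall>f\<in>M. C_op M f = P_const f) \<and>
                (mahler q)\<^sup>2 / (circle_norm2 q)\<^sup>2 = 1 / (1 + (cmod l)\<^sup>2) \<and>
                1 / (1 + (cmod l)\<^sup>2) < 1 \<and>
                fredholm_det M (\<lambda>f. f - adjoint_on M (X_op M) (X_op M f)) = 1"
    using l
    by (simp add: Let_def M q P_z_P_w_UNIV X_op_UNIV C_op_UNIV mahler_linear circle_norm2_linear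
        fredholm_det_UNIV_id)
qed

end
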